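(* For all integers $r\geq 2$ and $k_1,\dots,k_r\geq 3$, \[ M_r(k_1,\dots,k_r)=\sum_{i=1}^r\sum_{\substack{j=1\\ j\neq i}}^r\sum_{m=3}^{k_j} m\binom{k_1+\cdots+k_r-2r-m+1}{a^{(i,j,m)}_1,\dots,a^{(i,j,m)}_r}, \] where $a^{(i,j,m)}_i=k_i-3$, $a^{(i,j,m)}_j=k_j-m$, and $a^{(i,j,m)}_\ell=k_\ell-2$ for $\ell\notin\{i,j\}$. In particular, for integers $r\geq 2$ and $k\geq 3$, \[ M_r(k)=r(r-1)\sum_{m=3}^k m\binom{r(k-2)-m+1}{k-2,\dots,k-2,k-3,k-m}, \] where $k-2$ appears $r-2$ times in the lower entries.
   Context: For each integer $r\geq 2$, $M_r:\mathbb{Z}_{\geq 2}^r\to\mathbb{Z}_{\geq 0}$ denotes the family of functions uniquely determined by: (i) $M_2(k_1,k_2)=\binom{k_1+k_2-2}{k_1-1}$ for $k_1,k_2\geq 2$; (ii) for $r\geq 2$ and $k_1,\dots,k_r\geq 2$, inserting a coordinate equal to $2$ at any position of $(k_1,\dots,k_r)$ gives an $(r+1)$-tuple at which $M_{r+1}$ equals $M_r(k_1,\dots,k_r)$; (iii) for $k_1,\dots,k_r\geq 3$, $M_r(k_1,\dots,k_r)=\sum_{i=1}^r M_r(k_1,\dots,k_i-1,\dots,k_r)$ (the $i$-th coordinate decreased by $1$). $M_r(k)$ means $M_r(k,\dots,k)$. The multinomial coefficient $\binom{n}{a_1,\dots,a_r}$ with $a_1+\cdots+a_r=n$, $a_i\geq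 0$, equals $\frac{n!}{a_1!\cdots a_r!}$. *)

theory Defs
  imports Main "HOL.Binomial"
begin

text \<open>
  A tuple \<open>(k\<^sub>1, \<dots>, k\<^sub>r)\<close> is a list of length \<open>r\<close>, so \<open>M\<^sub>r\<close> is the restriction of a single
  function \<open>M\<close> on lists to the lists of length \<open>r\<close>. Coordinates are numbered from \<open>0\<close>.
  Nothing is said about \<open>M\<close> on lists shorter than \<open>2\<close> or with an entry below \<open>2\<close>.
\<close>

definition M_family :: "(nat list \<Rightarrow> nat) \<Rightarrow> bool" where
  "M_family M \<longleftrightarrow>
     (\<forall>k\<^sub>1 k\<^sub>2. k\<^sub>1 \<ge> 2 \<longrightarrow> k\<^sub>2 \<ge> 2 \<longrightarrow> M [k\<^sub>1, k\<^sub>2] = (k\<^sub>1 + k\<^sub>2 - 2) choose (k\<^sub>1 - 1)) \<and>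
     (\<forall>xs ys. length (xs @ ys) \<ge> 2 \<longrightarrow> (\<forall>k\<in>set (xs @ ys). k \<ge> 2) \<longrightarrow>
        M (xs @ [2] @ ys) = M (xs @ ys)) \<and>
     (\<forall>ks. length ks \<ge> 2 \<longrightarrow> (\<forall>k\<in>set ks. k \<ge> 3) \<longrightarrow>
        M ks = (\<Sum>i<length ks. M (ks[i := ks ! i - 1])))"

text \<open>Only meant for \<open>sum_list as = n\<close>, where the division is exact.\<close>

definition multinomial :: "nat \<Rightarrow> nat list \<Rightarrow> nat" where
  "multinomial n as = fact n div (\<Prod>a\<leftarrow>as. fact a)"

lemma prod_list_fact_dvd: "(\<Prod>a\<leftarrow>as. fact a :: nat) dvd fact (sum_list as)"
proof (induction as)
  case Nil
  then show ?case by simp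
next
  case (Cons a as)
  have "fact a * (\<Prod>a\<leftarrow>as. fact a :: nat) dvd fact a * fact (sum_list as)"
    using Cons by (simp add: mult_dvd_mono)
  also have "\<dots> dvd (fact (a + sum_list as) :: nat)"
    by (rule fact_fact_dvd_fact)
  finally show ?case by simp
qed

lemma multinomial_exact:
  assumes "sum_list as = n"
  shows "multinomial n as * (\<Prod>a\<leftarrow>as. fact a) = fact n"
  using prod_list_fact_dvd[of as] assms by (simp add: multinomial_def)

text \<open>
  The three conditions determine \<open>M\<close> on all lists of length at least \<open>2\<close> with entries at
  least \<open>2\<close>, and they are consistent.
\<close>

lemma M_family_unique:
  assumes "M_family M" "M_family M'" "length ks \<ge> 2" "\<forall>k\<in>set ks. k \<ge> 2"
  shows "M ks = M' ks"
  using assms(3,4)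
proof (induction "length ks + sum_list ks" arbitrary: ks rule: less_induct)
  case less
  consider "length ks = 2" | "length ks > 2" "2 \<in> set ks" | "2 \<notin> set ks"
    using less.prems(1) by linarith
  then show ?case
  proof cases
    case 1
    then obtain a b where ks: "ks = [a, b]"
      by (auto simp: length_Suc_conv numeral_2_eq_2)
    then show ?thesis
      using assms(1,2) less.prems by (simp add: M_family_def)
  next
    case 2
    then obtain xs ys where ks: "ks = xs @ 2 # ys"
      by (meson split_list)
    have "M (xs @ ys) = M' (xs @ ys)"
      using less.prems 2 by (intro less.hyps) (auto simp: ks)
    moreover have "M (xs @ [2] @ ys) = M (xs @ ys)" "M' (xs @ [2] @ ys) = M' (xs @ ys)"
      using assms(1,2) less.prems 2 by (auto simp: ks M_family_def)
    ultimately show ?thesis by (simp add: ks)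
  next
    case 3
    have ge3: "\<forall>k\<in>set ks. k \<ge> 3"
    proof
      fix k assume "k \<in> set ks"
      then have "k \<ge> 2" "k \<noteq> 2" using less.prems(2) 3 by auto
      then show "k \<ge> 3" by simp
    qed
    have "M (ks[i := ks ! i - 1]) = M' (ks[i := ks ! i - 1])" if i: "i < length ks" for i
    proof (rule less.hyps)
      have k: "ks ! i \<ge> 3" using ge3 i by simp
      have "sum_list (ks[i := ks ! i - 1]) = sum_list ks + (ks ! i - 1) - ks ! i"
        using i by (simp add: sum_list_update)
      moreover have "ks ! i \<le> sum_list ks"
        using i by (simp add: member_le_sum_list)
      ultimately show "length (ks[i := ks ! i - 1]) + sum_list (ks[i := ks ! i - 1])
          < length ks + sum_list ks"
        using k by simp
      show "\<forall>k\<in>set (ks[i := ks ! i - 1]). 2 \<le> k"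
      proof
        fix x assume "x \<in> set (ks[i := ks ! i - 1])"
        then have "x = ks ! i - 1 \<or> x \<in> set ks"
          using set_update_subset_insert by fastforce
        then show "2 \<le> x" using k less.prems(2) by auto
      qed
    qed (use less.prems in simp)
    then have "(\<Sum>i<length ks. M (ks[i := ks ! i - 1])) = (\<Sum>i<length ks. M' (ks[i := ks ! i - 1]))"
      by simp
    then show ?thesis
      using assms(1,2) less.prems(1) ge3 by (simp add: M_family_def)
  qed
qed

function M_rec :: "nat list \<Rightarrow> nat" where
  "M_rec ks = (let c = filter (\<lambda>k. k \<noteq> 2) ks in
     if c = [] then 2
     else if length c = 1 then c ! 0
     else if length c = 2 then (c ! 0 + c ! 1 - 2) choose (c ! 0 - 1)
     else if \<exists>k\<in>set c. k < 2 then 0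
     else (\<Sum>i<length c. M_rec (c[i := c ! i - 1])))"
  by auto
termination
proof (relation "measure sum_list", goal_cases)
  case 1
  then show ?case by simp
next
  case (2 ks c i)
  have i: "i < length c" using 2 by simp
  have k: "c ! i \<ge> 2" using 2 i by (meson not_less nth_mem)
  have "sum_list c \<le> sum_list ks"
    unfolding 2(1) by (induction ks) auto
  moreover have "sum_list (c[i := c ! i - 1]) = sum_list c + (c ! i - 1) - c ! i"
    using i by (simp add: sum_list_update)
  moreover have "c ! i \<le> sum_list c"
    using i by (simp add: member_le_sum_list)
  ultimately show ?case using k by simp
qed

declare M_rec.simps [simp del]

lemma M_rec_2:
  assumes "a \<ge> 2" "b \<ge> 2"
  shows "M_rec [a, b] = (a + b - 2) choose (a - 1)"
proof -
  have "Suc n choose n = Suc n" for n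
    by (simp add: binomial_symmetric[of n "Suc n"])
  from this[of "a - 1"] show ?thesis
    using assms by (auto simp: M_rec.simps[of "[a, b]"] Let_def)
qed

lemma M_family_M_rec: "M_family M_rec"
  unfolding M_family_def
proof (intro conjI allI impI)
  fix a b :: nat
  assume "a \<ge> 2" "b \<ge> 2"
  then show "M_rec [a, b] = (a + b - 2) choose (a - 1)" by (rule M_rec_2)
next
  fix xs ys :: "nat list"
  show "M_rec (xs @ [2] @ ys) = M_rec (xs @ ys)"
    by (simp add: M_rec.simps[of "xs @ 2 # ys"] M_rec.simps[of "xs @ ys"])
next
  fix ks :: "nat list"
  assume len: "length ks \<ge> 2" and ge3: "\<forall>k\<in>set ks. k \<ge> 3"
  show "M_rec ks = (\<Sum>i<length ks. M_rec (ks[i := ks ! i - 1]))"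
  proof (cases "length ks = 2")
    case True
    then obtain a b where ks: "ks = [a, b]"
      by (auto simp: length_Suc_conv numeral_2_eq_2)
    obtain a' where a: "a = a' + 3" using ge3 ks by (auto simp: le_iff_add add.commute)
    obtain b' where b: "b = b' + 3" using ge3 ks by (auto simp: le_iff_add add.commute)
    have "M_rec [a, b] = M_rec [a - 1, b] + M_rec [a, b - 1]"
      by (simp add: M_rec_2 a b eval_nat_numeral)
    then show ?thesis by (simp add: ks numeral_2_eq_2 lessThan_Suc)
  next
    case False
    have "filter (\<lambda>k. k \<noteq> 2) ks = ks" "\<not> (\<exists>k\<in>set ks. k < 2)" "ks \<noteq> []"
      using ge3 len by (force intro!: filter_True)+
    then show ?thesis
      using False len by (subst M_rec.simps) (simp add: Let_def)
  qed
qed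

end

theory Submission
  imports Defs
begin

text \<open>
  Coordinates equal to \<open>2\<close> can be ignored, so the recursion (iii) stays valid for tuples with
  entries at least \<open>2\<close> when only the coordinates that are at least \<open>3\<close> are decreased, as long as
  there are two of them; with a single one left, of value \<open>m\<close>, the value of \<open>M\<close> is \<open>m\<close>.
  Hence \<open>M\<close> counts decreasing lattice paths that stop when a single coordinate \<open>j\<close> exceeds \<open>2\<close>,
  weighted by its final value \<open>m\<close>. If \<open>i\<close> is the coordinate decreased in the last step, the
  number of such paths is the multinomial coefficient of the steps before it. The formula is
  verified by induction from Pascal's rule for multinomial coefficients, whose exceptional case
  (all lower entries \<open>0\<close>) accounts for the paths of length one.
\<close>

section \<open>Pascal's rule for multinomial coefficients\<close>

text \<open>With the lower entries given by a function, decreasing one of them is a function update.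
  The upper entry is their sum, so the division in \<open>multinomial\<close> is exact.\<close>

definition multinom :: "nat \<Rightarrow> (nat \<Rightarrow> nat) \<Rightarrow> nat" where
  "multinom r a = multinomial (\<Sum>l<r. a l) (map a [0..<r])"

lemma multinom_mult_prod_fact: "multinom r a * (\<Prod>l<r. fact (a l)) = fact (\<Sum>l<r. a l)"
proof -
  have "sum_list (map a [0..<r]) = (\<Sum>l<r. a l)"
    by (simp add: sum_list_distinct_conv_sum_set atLeast0LessThan)
  moreover have "(\<Prod>x\<leftarrow>map a [0..<r]. fact x) = (\<Prod>l<r. fact (a l) :: nat)"
    by (simp add: prod.distinct_set_conv_list[symmetric] atLeast0LessThan comp_def)
  ultimately show ?thesis
    using multinomial_exact[of "map a [0..<r]"] by (simp add: multinom_def)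
qed

text \<open>Multiplied by the product of all \<open>fact (a l)\<close>, the summand for
  \<open>p\<close> becomes \<open>a p * fact (S - 1)\<close>, and these add up to
  \<open>fact S\<close>. If all entries are 0 there is nothing to decrease, hence the extra
  1.\<close>

lemma multinom_pascal:
  "multinom r a = (if \<forall>l<r. a l = 0 then 1 else 0) +
     (\<Sum>p<r. if a p > 0 then multinom r (a(p := a p - 1)) else 0)"
proof (cases "\<forall>l<r. a l = 0")
  case True
  then show ?thesis
    using multinom_mult_prod_fact[of r a] by (simp add: sum.neutral)
next
  case False
  define P S where "P = (\<Prod>l<r. fact (a l) :: nat)" and "S = (\<Sum>l<r. a l)"
  have "S > 0"
    using False by (intro gr0I) (auto simp: S_def)
  \<comment> \<open>A factor \<open>a p\<close> splits off from \<open>fact (a p)\<close>; for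
    \<open>a p = 0\<close> both sides are 0.\<close>
  have "(if a p > 0 then multinom r (a(p := a p - 1)) else 0) * P = a p * fact (S - 1)"
    if p: "p < r" for p
  proof (cases "a p > 0")
    case True
    let ?b = "a(p := a p - 1)"
    have "(\<Prod>l\<in>{..<r} - {p}. fact (?b l) :: nat) = (\<Prod>l\<in>{..<r} - {p}. fact (a l))"
      by (intro prod.cong) auto
    then have "P = a p * (\<Prod>l<r. fact (?b l))"
      using p True unfolding P_def
      by (simp add: prod.remove[of "{..<r}" p] fact_reduce[of "a p"])
    moreover have "(\<Sum>l\<in>{..<r} - {p}. ?b l) = (\<Sum>l\<in>{..<r} - {p}. a l)"
      by (intro sum.cong) auto
    then have "(\<Sum>l<r. ?b l) = S - 1"
      using p True unfolding S_def by (simp add: sum.remove[of "{..<r}" p])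
    ultimately show ?thesis
      using True multinom_mult_prod_fact[of r ?b] by (simp add: mult.left_commute)
  qed auto
  then have "(\<Sum>p<r. if a p > 0 then multinom r (a(p := a p - 1)) else 0) * P
      = (\<Sum>p<r. a p * fact (S - 1))"
    unfolding sum_distrib_right by (intro sum.cong) auto
  also have "\<dots> = fact S"
    using \<open>S > 0\<close> by (simp add: sum_distrib_right[symmetric] S_def[symmetric] fact_reduce[of S])
  also have "\<dots> = multinom r a * P"
    by (simp add: multinom_mult_prod_fact P_def S_def)
  finally show ?thesis
    using False by (auto simp: P_def)
qed

section \<open>The recursion in the presence of coordinates equal to two\<close>

lemma sum_lessThan_add:
  fixes f :: "nat \<Rightarrow> 'a::comm_monoid_add"
  shows "(\<Sum>i<m + n. f i) = (\<Sum>i<m. f i) + (\<Sum>i<n. f (m + i))"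
  by (induction n) (simp_all add: add.assoc)

text \<open>The inserted position contributes 0 and the other summands do not change when
  \<open>x\<close> is dropped. \<open>F\<close> also receives the entry before its update, so that
  it can contain a test on it.\<close>

lemma sum_list_update_insert:
  fixes F :: "'a \<Rightarrow> 'a list \<Rightarrow> 'b::comm_monoid_add"
  assumes "F x (xs @ g x # ys) = 0"
    and "\<And>i. i < length xs \<Longrightarrow>
      F (xs ! i) (xs[i := g (xs ! i)] @ x # ys) = F (xs ! i) (xs[i := g (xs ! i)] @ ys)"
    and "\<And>i. i < length ys \<Longrightarrow>
      F (ys ! i) (xs @ x # ys[i := g (ys ! i)]) = F (ys ! i) (xs @ ys[i := g (ys ! i)])"
  defines "h \<equiv> \<lambda>zs i. F (zs ! i) (zs[i := g (zs ! i)])"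
  shows "(\<Sum>i<length (xs @ x # ys). h (xs @ x # ys) i) = (\<Sum>i<length (xs @ ys). h (xs @ ys) i)"
proof -
  have "(\<Sum>i<length (xs @ x # ys). h (xs @ x # ys) i) =
      (\<Sum>i<length xs. h (xs @ x # ys) i) + (\<Sum>i<Suc (length ys). h (xs @ x # ys) (length xs + i))"
    using sum_lessThan_add[of "h (xs @ x # ys)" "length xs" "Suc (length ys)"] by simp
  \<comment> \<open>Index 0 of the second block is the inserted position.\<close>
  also have "(\<Sum>i<Suc (length ys). h (xs @ x # ys) (length xs + i)) =
      (\<Sum>i<length ys. h (xs @ ys) (length xs + i))"
    using assms(1,3) unfolding sum.lessThan_Suc_shift
    by (simp add: h_def list_update_append nth_append)
  also have "(\<Sum>i<length xs. h (xs @ x # ys) i) = (\<Sum>i<length xs. h (xs @ ys) i)"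
    using assms(2) by (simp add: h_def list_update_append nth_append)
  finally show ?thesis
    by (simp add: sum_lessThan_add)
qed

lemma M_family_insert_2:
  assumes "M_family M" "length (xs @ ys) \<ge> 2" "\<forall>k\<in>set (xs @ ys). k \<ge> 2"
  shows "M (xs @ 2 # ys) = M (xs @ ys)"
  using assms by (simp add: M_family_def)

lemma set_list_update_ge:
  fixes xs :: "nat list"
  assumes "\<forall>k\<in>set xs. k \<ge> c" "x \<ge> c"
  shows "\<forall>k\<in>set (xs[i := x]). k \<ge> c"
  using assms set_update_subset_insert[of xs i x] by auto

text \<open>Induction on the length: a 2 is removed by (ii) and put back in each summand; without a
  2 this is (iii). The two entries that are at least 3 keep the tuple long enough for (ii).\<close>

lemma M_family_recursion:
  assumes M: "M_family M" and "\<forall>k\<in>set ks. k \<ge> 2" "length (filter (\<lambda>k. k \<ge> 3) ks) \<ge> 2"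
  shows "M ks = (\<Sum>i<length ks. if ks ! i \<ge> 3 then M (ks[i := ks ! i - 1]) else 0)"
  using assms(2,3)
proof (induction "length ks" arbitrary: ks rule: less_induct)
  case less
  show ?case
  proof (cases "2 \<in> set ks")
    case False
    have "\<forall>k\<in>set ks. k \<ge> 3"
    proof
      fix k assume "k \<in> set ks"
      then have "k \<ge> 2" "k \<noteq> 2" using less.prems(1) False by auto
      then show "k \<ge> 3" by simp
    qed
    moreover have "length ks \<ge> 2"
      using less.prems(2) length_filter_le order_trans by blast
    ultimately show ?thesis
      using M by (simp add: M_family_def)
  next
    case True
    then obtain xs ys where ks: "ks = xs @ 2 # ys"
      by (meson split_list)
    have len: "length (xs @ ys) \<ge> 2"
      using less.prems(2) length_filter_le[of "\<lambda>k. k \<ge> 3" "xs @ ys"] by (simp add: ks)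
    have ge: "\<forall>k\<in>set xs. k \<ge> 2" "\<forall>k\<in>set ys. k \<ge> 2"
      using less.prems(1) by (auto simp: ks)
    have "M ks = M (xs @ ys)"
      using M len ge by (auto simp: ks intro!: M_family_insert_2)
    also have "\<dots> = (\<Sum>i<length (xs @ ys).
        if (xs @ ys) ! i \<ge> 3 then M ((xs @ ys)[i := (xs @ ys) ! i - 1]) else 0)"
      using less.prems by (intro less.hyps) (auto simp: ks)
    also have "\<dots> = (\<Sum>i<length ks. if ks ! i \<ge> 3 then M (ks[i := ks ! i - 1]) else 0)"
      unfolding ks
    proof (rule sum_list_update_insert[where F = "\<lambda>z zs. if z \<ge> 3 then M zs else 0"
          and g = "\<lambda>z. z - 1", symmetric])
      fix i assume "i < length xs"
      show "(if xs ! i \<ge> 3 then M (xs[i := xs ! i - 1] @ 2 # ys) else 0) =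
          (if xs ! i \<ge> 3 then M (xs[i := xs ! i - 1] @ ys) else 0)"
        using M_family_insert_2[OF M, of "xs[i := xs ! i - 1]" ys] len ge(2)
          set_list_update_ge[OF ge(1), of "xs ! i - 1" i]
        by (simp add: ball_Un)
    next
      fix i assume "i < length ys"
      show "(if ys ! i \<ge> 3 then M (xs @ 2 # ys[i := ys ! i - 1]) else 0) =
          (if ys ! i \<ge> 3 then M (xs @ ys[i := ys ! i - 1]) else 0)"
        using M_family_insert_2[OF M, of xs "ys[i := ys ! i - 1]"] len ge(1)
          set_list_update_ge[OF ge(2), of "ys ! i - 1" i]
        by (simp add: ball_Un)
    qed simp
    finally show ?thesis .
  qed
qed

text \<open>Removing twos by (ii) until one is left leads to \<open>M [2, k]\<close> or
  \<open>M [k, 2]\<close>, both equal to \<open>k\<close>. The last 2 has to stay because (ii) does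
  not lead down to length 1.\<close>

lemma M_family_replicate_2:
  assumes "M_family M" "k \<ge> 2" "a + b \<ge> 1"
  shows "M (replicate a 2 @ k # replicate b 2) = k"
  using assms(3)
proof (induction "a + b" arbitrary: a b rule: less_induct)
  case less
  consider "a = 1" "b = 0" | "a = 0" "b = 1" | a' where "a = Suc a'" "a' + b \<ge> 1"
    | b' where "b = Suc b'" "a + b' \<ge> 1"
  proof (cases a)
    case 0
    then show thesis using less.prems that(2) that(4)[of "b - 1"] by (cases "b = 1") simp_all
  next
    case (Suc a')
    then show thesis using that(1) that(3)[of a'] by (cases "a' + b = 0") simp_all
  qed
  then show ?case
  proof cases
    case 1
    then show ?thesis using assms(1,2) by (simp add: M_family_def)
  next
    case 2
    have "k choose (k - 1) = k"
      using assms(2) binomial_symmetric[of "k - 1" k] by simp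
    then show ?thesis using 2 assms(1,2) by (simp add: M_family_def)
  next
    case 3
    then have "M ([] @ 2 # replicate a' 2 @ k # replicate b 2) =
        M ([] @ replicate a' 2 @ k # replicate b 2)"
      using assms(2) by (intro M_family_insert_2[OF assms(1)]) auto
    then show ?thesis using 3 less.hyps[of a' b] by simp
  next
    case 4
    then have "M ((replicate a 2 @ [k]) @ 2 # replicate b' 2) =
        M ((replicate a 2 @ [k]) @ replicate b' 2)"
      using assms(2) by (intro M_family_insert_2[OF assms(1)]) auto
    then show ?thesis using 4 less.hyps[of a b'] by simp
  qed
qed

section \<open>The explicit formula\<close>

lemma map_upt_list_update:
  "(map f [0..<r])[p := x] = map (f(p := x)) [0..<r]"
  by (rule nth_equalityI) (auto simp: nth_list_update)

definition active :: "nat \<Rightarrow> (nat \<Rightarrow> nat) \<Rightarrow> nat set" where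
  "active r k = {l. l < r \<and> k l \<ge> 3}"

lemma finite_active [simp]: "finite (active r k)"
  by (simp add: active_def)

lemma M_family_recursion_fun:
  assumes "M_family M" "\<forall>l<r. k l \<ge> 2" "card (active r k) \<ge> 2"
  shows "M (map k [0..<r]) =
    (\<Sum>p<r. if k p \<ge> 3 then M (map (k(p := k p - 1)) [0..<r]) else 0)"
proof -
  have "length (filter (\<lambda>x. x \<ge> 3) (map k [0..<r])) = card (active r k)"
    by (auto simp: length_filter_conv_card active_def intro!: arg_cong[where f = card])
  then show ?thesis
    using assms M_family_recursion[of M "map k [0..<r]"]
    by (simp add: map_upt_list_update cong: if_cong)
qed

lemma M_family_single:
  assumes "M_family M" "r \<ge> 2" "j < r" "k j \<ge> 2" "\<forall>l<r. l \<noteq> j \<longrightarrow> k l = 2"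
  shows "M (map k [0..<r]) = k j"
proof -
  have "map k [0..<r] = replicate j 2 @ k j # replicate (r - Suc j) 2"
    using assms by (intro nth_equalityI) (auto simp: nth_append nth_Cons')
  then show ?thesis
    using assms M_family_replicate_2[of M "k j" j "r - Suc j"] by simp
qed

section \<open>Weighted path counts and their recursion\<close>

definition lower :: "(nat \<Rightarrow> nat) \<Rightarrow> nat \<Rightarrow> nat \<Rightarrow> nat \<Rightarrow> nat \<Rightarrow> nat" where
  "lower k i j m = (\<lambda>l. if l = i then k i - 3 else if l = j then k j - m else k l - 2)"

text \<open>Number of paths on which \<open>j\<close> ends at \<open>m\<close> and the last step
  takes \<open>i\<close> from 3 to 2, weighted by \<open>m\<close>; \<open>lower\<close> counts the
  decreases of each coordinate before that step. The test excludes the spurious terms that truncated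
  subtraction would produce.\<close>

definition path_term :: "nat \<Rightarrow> (nat \<Rightarrow> nat) \<Rightarrow> nat \<Rightarrow> nat \<Rightarrow> nat \<Rightarrow> nat" where
  "path_term r k i j m =
     (if k i \<ge> 3 \<and> k j \<ge> m then m * multinom r (lower k i j m) else 0)"

text \<open>For \<open>i \<noteq> j\<close>, one decrease of \<open>i\<close> now ends the path and
  leaves \<open>j\<close> as the only coordinate above 2.\<close>

definition last_step :: "nat \<Rightarrow> (nat \<Rightarrow> nat) \<Rightarrow> nat \<Rightarrow> nat \<Rightarrow> bool" where
  "last_step r k i j \<longleftrightarrow> k i = 3 \<and> k j \<ge> 3 \<and> (\<forall>l<r. l \<noteq> i \<longrightarrow> l \<noteq> j \<longrightarrow> k l = 2)"

text \<open>Pascal's rule for the entries of \<open>lower\<close>: when the test in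
  \<open>path_term\<close> holds, they are all 0 exactly if the next step is the last one and
  \<open>j\<close> already has its final value \<open>m\<close>.\<close>

lemma path_term_rec:
  assumes k: "\<forall>l<r. k l \<ge> 2" and "i < r" "j < r" "i \<noteq> j" "m \<ge> 3"
  shows "path_term r k i j m = (if last_step r k i j \<and> k j = m then m else 0) +
    (\<Sum>p<r. if k p \<ge> 3 then path_term r (k(p := k p - 1)) i j m else 0)"
proof (cases "k i \<ge> 3 \<and> k j \<ge> m")
  case False
  \<comment> \<open>A decrease cannot restore the failed test, and \<open>last_step\<close> with
    \<open>k j = m\<close> would imply it.\<close>
  then show ?thesis
    using \<open>m \<ge> 3\<close> by (auto simp: path_term_def last_step_def intro!: sum.neutral)
next
  case True
  let ?a = "lower k i j m"
  have step: "(if ?a p > 0 then m * multinom r (?a(p := ?a p - 1)) else 0) =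
      (if k p \<ge> 3 then path_term r (k(p := k p - 1)) i j m else 0)" if "p < r" for p
  proof (cases "?a p > 0")
    case pos: True
    have "k p \<ge> 3" "(k(p := k p - 1)) i \<ge> 3" "(k(p := k p - 1)) j \<ge> m"
      using pos True assms by (auto simp: lower_def split: if_splits)
    moreover have "lower (k(p := k p - 1)) i j m = ?a(p := ?a p - 1)"
      using \<open>i \<noteq> j\<close> by (auto simp: lower_def fun_eq_iff)
    ultimately show ?thesis
      using pos by (simp add: path_term_def del: fun_upd_apply)
  next
    case zero: False
    \<comment> \<open>The entry is 0 for \<open>p = i\<close> with \<open>k i = 3\<close>, for
      \<open>p = j\<close> with \<open>k j = m\<close>, or elsewhere with \<open>k p = 2\<close>. In
      the first two cases the decreased tuple fails the test in \<open>path_term\<close>.\<close>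
    then show ?thesis
      using True assms by (auto simp: lower_def path_term_def split: if_splits)
  qed
  have "(\<forall>l<r. ?a l = 0) \<longleftrightarrow> last_step r k i j \<and> k j = m"
  proof
    assume a: "\<forall>l<r. ?a l = 0"
    have "k i = 3" "k j = m"
      using a[rule_format, of i] a[rule_format, of j] True assms by (auto simp: lower_def)
    moreover have "k l = 2" if "l < r" "l \<noteq> i" "l \<noteq> j" for l
      using a[rule_format, of l] k that by (simp add: lower_def order_antisym)
    ultimately show "last_step r k i j \<and> k j = m"
      using \<open>m \<ge> 3\<close> by (simp add: last_step_def)
  qed (auto simp: lower_def last_step_def)
  then have "path_term r k i j m = (if last_step r k i j \<and> k j = m then m else 0) +
      (\<Sum>p<r. if ?a p > 0 then m * multinom r (?a(p := ?a p - 1)) else 0)"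
    using True
    by (simp add: path_term_def multinom_pascal[of r ?a] distrib_left sum_distrib_left
          if_distrib[of "(*) m"] cong: if_cong)
  then show ?thesis
    using step by simp
qed

text \<open>The bound \<open>K\<close> on \<open>m\<close> does not depend on \<open>k\<close>, so that it survives the recursion.\<close>

definition path_sum :: "nat \<Rightarrow> nat \<Rightarrow> (nat \<Rightarrow> nat) \<Rightarrow> nat" where
  "path_sum K r k = (\<Sum>i<r. \<Sum>j\<in>{..<r} - {i}. \<Sum>m=3..K. path_term r k i j m)"

text \<open>\<open>path_term_rec\<close> is summed over \<open>i\<close>, \<open>j\<close>,
  \<open>m\<close>, and the decreased coordinate \<open>p\<close> is moved outermost. The extra
  terms are assigned to \<open>p = i\<close>; they require \<open>k i = 3\<close>, so they fit under
  the same test.\<close>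

lemma path_sum_rec:
  assumes k: "\<forall>l<r. k l \<ge> 2" and K: "\<forall>l<r. k l \<le> K"
  shows "path_sum K r k = (\<Sum>p<r. if k p \<ge> 3 then
      (\<Sum>j\<in>{..<r} - {p}. if last_step r k p j then k j else 0) + path_sum K r (k(p := k p - 1))
      else 0)"
proof -
  let ?D = "\<lambda>p i j m. if k p \<ge> 3 then path_term r (k(p := k p - 1)) i j m else 0"
  have "path_sum K r k = (\<Sum>i<r. \<Sum>j\<in>{..<r} - {i}. \<Sum>m=3..K.
      (if last_step r k i j \<and> k j = m then m else 0) + (\<Sum>p<r. ?D p i j m))"
    unfolding path_sum_def using k by (intro sum.cong refl path_term_rec) auto
  also have "\<dots> =
      (\<Sum>i<r. \<Sum>j\<in>{..<r} - {i}. \<Sum>m=3..K. if last_step r k i j \<and> k j = m then m else 0) +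
      (\<Sum>i<r. \<Sum>j\<in>{..<r} - {i}. \<Sum>m=3..K. \<Sum>p<r. ?D p i j m)"
    by (simp add: sum.distrib)
  also have "(\<Sum>i<r. \<Sum>j\<in>{..<r} - {i}. \<Sum>m=3..K. \<Sum>p<r. ?D p i j m) =
      (\<Sum>p<r. \<Sum>i<r. \<Sum>j\<in>{..<r} - {i}. \<Sum>m=3..K. ?D p i j m)"
    by (simp only: sum.swap[where A = "{3..K}" and B = "{..<r}"]
          sum.swap[where A = "{..<r} - {i}" and B = "{..<r}" for i])
       (rule sum.swap)
  also have "\<dots> = (\<Sum>p<r. if k p \<ge> 3 then path_sum K r (k(p := k p - 1)) else 0)"
    by (intro sum.cong refl) (simp add: path_sum_def)
  also have "(\<Sum>i<r. \<Sum>j\<in>{..<r} - {i}. \<Sum>m=3..K. if last_step r k i j \<and> k j = m then m else 0) =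
      (\<Sum>i<r. if k i \<ge> 3 then \<Sum>j\<in>{..<r} - {i}. if last_step r k i j then k j else 0 else 0)"
  proof (intro sum.cong refl)
    fix i assume "i \<in> {..<r}"
    \<comment> \<open>\<open>last_step\<close> gives \<open>k j \<ge> 3\<close> and the bound gives
      \<open>k j \<le> K\<close>, so exactly one \<open>m\<close> in the range matches.\<close>
    have "(\<Sum>m=3..K. if last_step r k i j \<and> k j = m then m else 0) =
        (if last_step r k i j then k j else 0)" if "j < r" for j
      using K that by (auto simp: last_step_def)
    then have "(\<Sum>j\<in>{..<r} - {i}. \<Sum>m=3..K. if last_step r k i j \<and> k j = m then m else 0) =
        (\<Sum>j\<in>{..<r} - {i}. if last_step r k i j then k j else 0)"
      by (intro sum.cong) auto
    then show "(\<Sum>j\<in>{..<r} - {i}. \<Sum>m=3..K. if last_step r k i j \<and> k j = m then m else 0) =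
        (if k i \<ge> 3 then \<Sum>j\<in>{..<r} - {i}. if last_step r k i j then k j else 0 else 0)"
      by (auto simp: last_step_def)
  qed
  finally show ?thesis
    unfolding sum.distrib[symmetric] by (elim trans) (intro sum.cong, simp_all)
qed

section \<open>Equality of \<open>M\<close> and the path sum\<close>

lemma path_sum_eq_0:
  assumes "card (active r k) < 2"
  shows "path_sum K r k = 0"
  unfolding path_sum_def
proof (intro sum.neutral ballI)
  fix i j m assume ij: "i \<in> {..<r}" "j \<in> {..<r} - {i}" and m: "m \<in> {3..K}"
  \<comment> \<open>A nonzero term would need \<open>k i \<ge> 3\<close> and
    \<open>k j \<ge> m \<ge> 3\<close>, thus two active coordinates.\<close>
  have "\<not> {i, j} \<subseteq> active r k"
    using assms ij card_mono[of "active r k" "{i, j}"] by auto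
  then show "path_term r k i j m = 0"
    using ij m by (auto simp: path_term_def active_def)
qed

text \<open>Induction on the sum of the coordinates; both sides are sums over the decreased
  coordinate \<open>p\<close>. If two coordinates stay active, the induction hypothesis applies.
  Otherwise the step ends the path at a single \<open>j\<close>, and both summands are
  \<open>k j\<close>.\<close>

lemma M_family_eq_path_sum:
  assumes M: "M_family M"
    and "\<forall>l<r. k l \<ge> 2" "\<forall>l<r. k l \<le> K" "card (active r k) \<ge> 2"
  shows "M (map k [0..<r]) = path_sum K r k"
  using assms(2-4)
proof (induction "\<Sum>l<r. k l" arbitrary: k rule: less_induct)
  case less
  have "card (active r k) \<le> r"
    using card_mono[of "{..<r}" "active r k"] by (auto simp: active_def)
  then have r: "r \<ge> 2"
    using less.prems(3) by simp
  have "M (map (k(p := k p - 1)) [0..<r]) =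
      (\<Sum>j\<in>{..<r} - {p}. if last_step r k p j then k j else 0) + path_sum K r (k(p := k p - 1))"
    if p: "p < r" "k p \<ge> 3" for p
  proof (cases "card (active r (k(p := k p - 1))) \<ge> 2")
    case True
    let ?k = "k(p := k p - 1)"
    \<comment> \<open>A last step would leave no active coordinate except \<open>j\<close>.\<close>
    have "\<not> last_step r k p j" for j
    proof
      assume "last_step r k p j"
      then have "active r ?k \<subseteq> {j}"
        by (force simp: last_step_def active_def split: if_splits)
      then show False
        using True card_mono[of "{j}" "active r ?k"] by simp
    qed
    moreover have "(\<Sum>l<r. ?k l) < (\<Sum>l<r. k l)"
      using p by (intro sum_strict_mono_ex1) auto
    then have "M (map ?k [0..<r]) = path_sum K r ?k"
      using less.prems p True by (intro less.hyps) (auto intro: order_trans[OF diff_le_self])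
    ultimately show ?thesis by simp
  next
    case False
    let ?k = "k(p := k p - 1)"
    have "active r k - {p} \<subseteq> active r ?k"
      by (auto simp: active_def)
    then have "card (active r k - {p}) \<le> card (active r ?k)"
      by (intro card_mono) auto
    moreover have "card (active r k) = Suc (card (active r k - {p}))"
      using p by (intro card.remove) (auto simp: active_def)
    \<comment> \<open>Only \<open>p\<close> can become inactive, so the number of active coordinates
      drops from two to exactly one.\<close>
    ultimately have "card (active r k - {p}) = 1" and card: "card (active r ?k) = 1"
      using False less.prems(3) by auto
    then obtain j where j: "active r k - {p} = {j}"
      by (auto simp: card_1_singleton_iff)
    have "active r ?k = {j}"
      using \<open>active r k - {p} \<subseteq> active r ?k\<close> j card by (auto simp: card_1_singleton_iff)
    have jp: "j < r" "j \<noteq> p" "k j \<ge> 3"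
      using j by (auto simp: active_def)
    have "p \<notin> active r ?k"
      using \<open>active r ?k = {j}\<close> jp by simp
    then have "k p = 3"
      using p by (simp add: active_def)
    have two: "k l = 2" if "l < r" "l \<noteq> p" "l \<noteq> j" for l
    proof -
      have "l \<notin> active r k" using j that by blast
      then show ?thesis using less.prems(1) that by (auto simp: active_def le_less)
    qed
    have "last_step r k p l \<longleftrightarrow> l = j" if "l < r" "l \<noteq> p" for l
      using two jp \<open>k p = 3\<close> that by (auto simp: last_step_def)
    then have "(\<Sum>l\<in>{..<r} - {p}. if last_step r k p l then k l else 0) =
        (\<Sum>l\<in>{..<r} - {p}. if l = j then k l else 0)"
      by (intro sum.cong) auto
    also have "\<dots> = k j"
      using jp by simp
    finally have "(\<Sum>l\<in>{..<r} - {p}. if last_step r k p l then k l else 0) = k j" .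
    moreover have "M (map ?k [0..<r]) = ?k j"
      using r jp two \<open>k p = 3\<close> by (intro M_family_single[OF M]) auto
    moreover have "path_sum K r ?k = 0"
      using card by (intro path_sum_eq_0) simp
    ultimately show ?thesis
      using jp by simp
  qed
  then show ?case
    unfolding M_family_recursion_fun[OF M less.prems(1,3)] path_sum_rec[OF less.prems(1,2)]
    by (intro sum.cong) auto
qed

section \<open>From path sums to the stated coefficients\<close>

lemma sum_lower:
  assumes k: "\<forall>l<r. k l \<ge> 2" and "i < r" "j < r" "i \<noteq> j" "k i \<ge> 3" "m \<le> k j"
  shows "(\<Sum>l<r. lower k i j m l) = (\<Sum>l<r. k l) + 1 - 2 * r - m"
proof -
  let ?R = "{..<r} - {i} - {j}"
  have split: "(\<Sum>l<r. f l) = f i + (f j + (\<Sum>l\<in>?R. f l))" for f :: "nat \<Rightarrow> nat"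
    using assms by (simp add: sum.remove[of "{..<r}" i] sum.remove[of "{..<r} - {i}" j])
  have "(\<Sum>l\<in>?R. lower k i j m l) + 2 * card ?R = (\<Sum>l\<in>?R. lower k i j m l + 2)"
    by (simp only: sum.distrib sum_constant) simp
  also have "\<dots> = (\<Sum>l\<in>?R. k l)"
    using k by (intro sum.cong) (auto simp: lower_def)
  moreover have "card ?R = r - 2"
    using assms by (simp add: card_Diff_singleton)
  ultimately have "(\<Sum>l\<in>?R. k l) = (\<Sum>l\<in>?R. lower k i j m l) + 2 * (r - 2)"
    by simp
  moreover have r: "r \<ge> 2"
    using assms by linarith
  moreover have "lower k i j m i = k i - 3" "lower k i j m j = k j - m"
    using assms by (auto simp: lower_def)
  \<comment> \<open>Compared with the sum of all \<open>k l - 2\<close>, coordinate \<open>i\<close>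
    loses 1 and \<open>j\<close> loses \<open>m - 2\<close>. The 1 is added first: for
    \<open>m \<ge> 3\<close> the sum of \<open>k\<close> can be as small as
    \<open>2 * r + m - 1\<close>, where subtracting first would truncate.\<close>
  ultimately show ?thesis
    using \<open>k i \<ge> 3\<close> \<open>m \<le> k j\<close> r unfolding split by linarith
qed

lemma M_family_formula:
  assumes "M_family M" "length ks \<ge> 2" "\<forall>k\<in>set ks. k \<ge> 3"
  defines "r \<equiv> length ks"
  shows "M ks = (\<Sum>i<r. \<Sum>j\<in>{..<r} - {i}. \<Sum>m=3..ks ! j.
    m * multinomial (sum_list ks + 1 - 2 * r - m)
      (map (\<lambda>l. if l = i then ks ! i - 3 else if l = j then ks ! j - m else ks ! l - 2) [0..<r]))"
proof -
  let ?k = "\<lambda>l. ks ! l" and ?K = "Max (set ks)"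
  have ge: "ks ! l \<ge> 3" if "l < r" for l
    using assms that by simp
  have le: "ks ! l \<le> ?K" if "l < r" for l
    using that by (simp add: r_def)
  have sum_ks: "(\<Sum>l<r. ks ! l) = sum_list ks"
    by (simp add: sum_list_sum_nth r_def atLeast0LessThan)
  have "active r ?k = {..<r}"
    using ge by (auto simp: active_def)
  then have "M (map ?k [0..<r]) = path_sum ?K r ?k"
    using assms ge le by (intro M_family_eq_path_sum) (auto intro: order_trans[of 2 3])
  then have "M ks = path_sum ?K r ?k"
    by (simp add: r_def map_nth)
  also have "\<dots> = (\<Sum>i<r. \<Sum>j\<in>{..<r} - {i}. \<Sum>m=3..ks ! j.
    m * multinomial (sum_list ks + 1 - 2 * r - m) (map (lower ?k i j m) [0..<r]))"
    unfolding path_sum_def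
  proof (intro sum.cong[OF refl])
    fix i j assume "i \<in> {..<r}" "j \<in> {..<r} - {i}"
    then have ij: "i < r" "j < r" "i \<noteq> j" by auto
    \<comment> \<open>Terms with \<open>m > ks ! j\<close> fail the test in
      \<open>path_term\<close>, so the common bound \<open>?K\<close> can be lowered to
      \<open>ks ! j\<close>.\<close>
    have "(\<Sum>m=3..?K. path_term r ?k i j m) = (\<Sum>m=3..ks ! j. path_term r ?k i j m)"
      using le[of j] ij by (intro sum.mono_neutral_right) (auto simp: path_term_def)
    also have "\<dots> = (\<Sum>m=3..ks ! j.
        m * multinomial (sum_list ks + 1 - 2 * r - m) (map (lower ?k i j m) [0..<r]))"
    proof (intro sum.cong refl)
      fix m assume "m \<in> {3..ks ! j}"
      moreover have "\<forall>l<r. ks ! l \<ge> 2"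
        using ge by (auto intro: order_trans[of 2 3])
      ultimately show "path_term r ?k i j m =
          m * multinomial (sum_list ks + 1 - 2 * r - m) (map (lower ?k i j m) [0..<r])"
        using ij ge[OF \<open>i < r\<close>] sum_lower[of r ?k i j m]
        by (simp add: path_term_def multinom_def sum_ks)
    qed
    finally show "(\<Sum>m=3..?K. path_term r ?k i j m) = \<dots>" .
  qed
  finally show ?thesis
    unfolding lower_def .
qed

text \<open>\<open>multinomial\<close> depends on the lower entries only through the product of
  their factorials, hence not on their order.\<close>

lemma multinomial_two_exceptions:
  assumes "i < r" "j < r" "i \<noteq> j"
  shows "multinomial n (map (\<lambda>l. if l = i then a else if l = j then b else c) [0..<r]) =
    multinomial n (replicate (r - 2) c @ [a, b])"
proof -
  have "(\<Prod>x\<leftarrow>map (\<lambda>l. if l = i then a else if l = j then b else c) [0..<r]. fact x) =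
      (\<Prod>l<r. fact (if l = i then a else if l = j then b else c) :: nat)"
    by (simp add: prod.distinct_set_conv_list[symmetric] atLeast0LessThan comp_def)
  also have "\<dots> = fact a * (fact b * (\<Prod>l\<in>{..<r} - {i} - {j}. fact c))"
    using assms by (simp add: prod.remove[of "{..<r}" i] prod.remove[of "{..<r} - {i}" j])
  also have "\<dots> = (\<Prod>x\<leftarrow>replicate (r - 2) c @ [a, b]. fact x)"
    using assms by (simp add: card_Diff_singleton numeral_2_eq_2)
  finally show ?thesis
    by (simp add: multinomial_def)
qed

theorem theorem3p4:
  fixes M :: "nat list \<Rightarrow> nat"
  assumes "M_family M"
  shows "(\<forall>r ks. r \<ge> 2 \<longrightarrow> length ks = r \<longrightarrow> (\<forall>k\<in>set ks. k \<ge> 3) \<longrightarrow>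
            M ks = (\<Sum>i<r. \<Sum>j\<in>{..<r} - {i}. \<Sum>m=3..ks ! j.
              m * multinomial (sum_list ks + 1 - 2 * r - m)
                (map (\<lambda>l. if l = i then ks ! i - 3 else if l = j then ks ! j - m else ks ! l - 2)
                  [0..<r])))
       \<and> (\<forall>r k. r \<ge> 2 \<longrightarrow> k \<ge> 3 \<longrightarrow>
            M (replicate r k) = r * (r - 1) * (\<Sum>m=3..k.
              m * multinomial (r * (k - 2) + 1 - m)
                (replicate (r - 2) (k - 2) @ [k - 3, k - m])))"
proof (intro conjI allI impI)
  fix r :: nat and ks :: "nat list"
  assume "r \<ge> 2" "length ks = r" "\<forall>k\<in>set ks. k \<ge> 3"
  then show "M ks = (\<Sum>i<r. \<Sum>j\<in>{..<r} - {i}. \<Sum>m=3..ks ! j.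
      m * multinomial (sum_list ks + 1 - 2 * r - m)
        (map (\<lambda>l. if l = i then ks ! i - 3 else if l = j then ks ! j - m else ks ! l - 2) [0..<r]))"
    using M_family_formula[OF assms, of ks] by simp
next
  fix r k :: nat
  assume r: "r \<ge> 2" and k: "k \<ge> 3"
  let ?S = "\<Sum>m=3..k. m * multinomial (r * (k - 2) + 1 - m)
    (replicate (r - 2) (k - 2) @ [k - 3, k - m])"
  have "r * k = r * (k - 2) + 2 * r"
    using k by (simp add: diff_mult_distrib2 mult.commute)
  \<comment> \<open>The upper entries agree:
    \<open>r * k + 1 - 2 * r = r * (k - 2) + 1\<close>.\<close>
  then have top: "Suc (r * k) - (2 * r + m) = Suc (r * (k - 2)) - m" for m
    by simp
  have "M (replicate r k) = (\<Sum>i<r. \<Sum>j\<in>{..<r} - {i}. \<Sum>m=3..replicate r k ! j.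
      m * multinomial (sum_list (replicate r k) + 1 - 2 * r - m)
        (map (\<lambda>l. if l = i then replicate r k ! i - 3 else if l = j then replicate r k ! j - m
           else replicate r k ! l - 2) [0..<r]))"
    using M_family_formula[OF assms, of "replicate r k"] r k by simp
  \<comment> \<open>By symmetry the inner sum is the same for all \<open>r * (r - 1)\<close> pairs
    of distinct \<open>i\<close> and \<open>j\<close>.\<close>
  also have "\<dots> = (\<Sum>i<r. \<Sum>j\<in>{..<r} - {i}. ?S)"
  proof (intro sum.cong[OF refl])
    fix i j assume ij: "i \<in> {..<r}" "j \<in> {..<r} - {i}"
    have "map (\<lambda>l. if l = i then replicate r k ! i - 3 else if l = j then replicate r k ! j - m
           else replicate r k ! l - 2) [0..<r] =
        map (\<lambda>l. if l = i then k - 3 else if l = j then k - m else k - 2) [0..<r]" for m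
      by (intro map_cong) auto
    then show "(\<Sum>m=3..replicate r k ! j.
        m * multinomial (sum_list (replicate r k) + 1 - 2 * r - m)
        (map (\<lambda>l. if l = i then replicate r k ! i - 3 else if l = j then replicate r k ! j - m
           else replicate r k ! l - 2) [0..<r])) = ?S"
      using ij by (simp add: sum_list_replicate multinomial_two_exceptions top del: map_eq_conv)
  qed
  also have "\<dots> = r * (r - 1) * ?S"
    by (simp add: card_Diff_singleton)
  finally show "M (replicate r k) = r * (r - 1) * ?S" .
qed

end
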